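(* The Baik-Rains distribution (with parameter $0$) stochastically dominates the Tracy-Widom GOE distribution: $F^0_{\rm stat}(r)<F_{\rm GOE}(r)$ for all $r\in\mathbb{R}$.
   Context: Let $u$ be the Hastings-McLeod solution of the Painlevé II equation $u_{xx}=2u^3+xu$, i.e. the unique solution with $u(x)\sim-\mathrm{Ai}(x)$ as $x\to\infty$ (so $u<0$ and $u'>0$ on $\mathbb{R}$). Define $$v(x)=-\int_x^\infty u(s)^2\,ds,\qquad y(x)=x+2u'(x)+2u(x)^2,\qquad F(x)=e^{\frac12\int_x^\infty v(s)\,ds},\qquad E(x)=e^{\frac12\int_x^\infty u(s)\,ds}.$$ The Tracy-Widom GUE and GOE distributions and the Baik-Rains distribution (with parameter $0$) are $$F_{\rm GUE}(x)=F(x)^2,\qquad F_{\rm GOE}(x)=F(x)E(x),\qquad F^0_{\rm stat}(x)=[1-y(x)v(x)]\,E(x)^4\,F_{\rm GUE}(x).$$ *)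

theory Defs
  imports "HOL-Analysis.Analysis" "HOL-Library.Landau_Symbols"
begin

text \<open>The integrand is not absolutely integrable on the half-line, so the integral defining the
  Airy function is improper: a limit of integrals over \<open>{0..T}\<close>.\<close>

definition airy_Ai :: "real \<Rightarrow> real" where
  "airy_Ai x = (1 / pi) * Lim at_top (\<lambda>T::real. integral {0..T} (\<lambda>t. cos (t ^ 3 / 3 + x * t)))"

definition painleve_II :: "(real \<Rightarrow> real) \<Rightarrow> bool" where
  "painleve_II u \<longleftrightarrow>
     (\<forall>x. u differentiable (at x) \<and>
          (deriv u has_real_derivative (2 * u x ^ 3 + x * u x)) (at x))"

text \<open>The Hastings-McLeod solution is the unique function with this property. Its existence,
  uniqueness, sign and monotonicity are theorems and are not built into the definition.\<close>

definition hastings_mcleod :: "(real \<Rightarrow> real) \<Rightarrow> bool" where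
  "hastings_mcleod u \<longleftrightarrow> painleve_II u \<and> u \<sim>[at_top] (\<lambda>x. - airy_Ai x)"

definition hm_v :: "(real \<Rightarrow> real) \<Rightarrow> real \<Rightarrow> real" where
  "hm_v u x = - integral {x..} (\<lambda>s. (u s)\<^sup>2)"

definition hm_y :: "(real \<Rightarrow> real) \<Rightarrow> real \<Rightarrow> real" where
  "hm_y u x = x + 2 * deriv u x + 2 * (u x)\<^sup>2"

definition hm_F :: "(real \<Rightarrow> real) \<Rightarrow> real \<Rightarrow> real" where
  "hm_F u x = exp (1 / 2 * integral {x..} (hm_v u))"

definition hm_E :: "(real \<Rightarrow> real) \<Rightarrow> real \<Rightarrow> real" where
  "hm_E u x = exp (1 / 2 * integral {x..} u)"

definition F_GUE :: "(real \<Rightarrow> real) \<Rightarrow> real \<Rightarrow> real" where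
  "F_GUE u x = (hm_F u x)\<^sup>2"

definition F_GOE :: "(real \<Rightarrow> real) \<Rightarrow> real \<Rightarrow> real" where
  "F_GOE u x = hm_F u x * hm_E u x"

text \<open>The Baik-Rains distribution with parameter 0.\<close>

definition F_stat0 :: "(real \<Rightarrow> real) \<Rightarrow> real \<Rightarrow> real" where
  "F_stat0 u x = (1 - hm_y u x * hm_v u x) * hm_E u x ^ 4 * F_GUE u x"

end

theory Submission
  imports Defs "HOL-Real_Asymp.Real_Asymp" "HOL-Complex_Analysis.Cauchy_Integral_Theorem"
begin

text \<open>
  Write \<open>F_stat0 = G F_GOE\<close> with \<open>G = (1 - y v) E\<^sup>3 F\<close>. From \<open>y' = 1 + 2 u y\<close> and \<open>v' = u\<^sup>2\<close> one gets
  \<open>2 G' = E\<^sup>3 F (u + v) (y (v - 2 u) - 3)\<close>, and \<open>G\<close> tends to 1 at infinity. The sign and monotonicity of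
  \<open>u\<close> on the whole line are not used, only that \<open>u\<close> is a global solution which is eventually
  negative and decays exponentially (by the shift of the Airy contour to \<open>Im z = \<surd>x\<close>).

  The set \<open>y > 0\<close> is an upper half-line on which \<open>u < 0\<close>, \<open>u' > 0\<close> and, because the solution does not
  blow up on the left, \<open>y' > 0\<close>. Hence \<open>y (v - 2 u) < 1 + y v < 1\<close> there, \<open>G\<close> increases to 1, and \<open>G < 1\<close>.
  Where \<open>y \<le> 0\<close>, \<open>1 - y v \<le> 1\<close> since \<open>v < 0\<close>, and it is enough that \<open>E < 1\<close> and \<open>F < 1\<close>. The former,
  i.e. that the integral of \<open>u\<close> over \<open>{x..}\<close> is negative, holds because the lobes of \<open>u\<close>, if it oscillates,
  shrink to the left.
\<close>

section \<open>Half-line integrals of continuous functions with exponential decay\<close>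

lemma exp_tail_integrable:
  fixes f :: "real \<Rightarrow> real"
  assumes cont: "continuous_on UNIV f" and bd: "\<And>x. X \<le> x \<Longrightarrow> \<bar>f x\<bar> \<le> C * exp (-x)"
  shows "f integrable_on {a..}"
proof -
  define b where "b = max a X"
  have g: "(\<lambda>x. C * exp (-x)) integrable_on {b..}"
    using has_integral_mult_right[OF has_integral_exp_minus_to_infinity[of 1 b], of C]
    by (simp add: integrable_on_def) blast
  have "f absolutely_integrable_on {b..}"
    by (rule measurable_bounded_by_integrable_imp_absolutely_integrable[OF _ _ g])
       (use bd cont in \<open>auto intro!: continuous_imp_measurable_on_sets_lebesgue
          intro: continuous_on_subset simp: b_def\<close>)
  then have fb: "f integrable_on {b..}"
    using set_lebesgue_integral_eq_integral(1) by blast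
  have "f integrable_on {a..b}"
    by (rule integrable_continuous_interval) (use cont in \<open>auto intro: continuous_on_subset\<close>)
  with fb have "f integrable_on ({a..b} \<union> {b..})"
  proof (intro integrable_Un)
    have "{a..b} \<inter> {b..} = {b}" by (auto simp: b_def)
    then show "negligible ({a..b} \<inter> {b..})" by simp
  qed
  moreover have "{a..b} \<union> {b..} = {a..}" by (auto simp: b_def)
  ultimately show ?thesis by simp
qed

lemma exp_tail_split:
  fixes f :: "real \<Rightarrow> real"
  assumes cont: "continuous_on UNIV f" and bd: "\<And>x. X \<le> x \<Longrightarrow> \<bar>f x\<bar> \<le> C * exp (-x)"
    and "a \<le> b"
  shows "integral {a..} f = integral {a..b} f + integral {b..} f"
proof -
  have "integral ({a..b} \<union> {b..}) f = integral {a..b} f + integral {b..} f"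
  proof (rule integral_Un)
    show "f integrable_on {a..b}"
      by (rule integrable_continuous_interval) (use cont in \<open>auto intro: continuous_on_subset\<close>)
    show "f integrable_on {b..}" by (rule exp_tail_integrable[OF cont bd])
    have "{a..b} \<inter> {b..} = {b}" using \<open>a \<le> b\<close> by auto
    then show "negligible ({a..b} \<inter> {b..})" by simp
  qed
  moreover have "{a..b} \<union> {b..} = {a..}" using \<open>a \<le> b\<close> by auto
  ultimately show ?thesis by simp
qed

text \<open>Near \<open>a\<close> the tail integral is a constant minus an integral with fixed lower
  limit \<open>a-1\<close>, so the fundamental theorem of calculus applies.\<close>

lemma exp_tail_has_derivative:
  fixes f :: "real \<Rightarrow> real"
  assumes cont: "continuous_on UNIV f" and bd: "\<And>x. X \<le> x \<Longrightarrow> \<bar>f x\<bar> \<le> C * exp (-x)"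
  shows "((\<lambda>x. integral {x..} f) has_real_derivative - f a) (at a)"
proof -
  have "((\<lambda>x. integral {a-1..x} f) has_real_derivative f a) (at a within {a-1..a+1})"
    by (rule integral_has_real_derivative) (use cont in \<open>auto intro: continuous_on_subset\<close>)
  then have d: "((\<lambda>x. integral {a-1..x} f) has_real_derivative f a) (at a)"
    by (simp add: at_within_Icc_at)
  have "((\<lambda>x. integral {a-1..} f - integral {a-1..x} f) has_real_derivative - f a) (at a)"
    by (rule derivative_eq_intros d refl | simp)+
  moreover have "\<forall>\<^sub>F x in nhds a. integral {x..} f = integral {a-1..} f - integral {a-1..x} f"
    using eventually_nhds_in_open[of "{a-1<..<a+1}" a]
  proof (simp, elim eventually_mono)
    fix x assume "a - 1 < x \<and> x < a + 1"
    then show "integral {x..} f = integral {a-1..} f - integral {a-1..x} f"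
      using exp_tail_split[of f X C "a-1" x] cont bd by simp
  qed
  ultimately show ?thesis
    by (subst DERIV_cong_ev[OF refl _ refl])
qed

lemma exp_tail_bound:
  fixes f :: "real \<Rightarrow> real"
  assumes cont: "continuous_on UNIV f" and bd: "\<And>x. X \<le> x \<Longrightarrow> \<bar>f x\<bar> \<le> C * exp (-x)"
    and "X \<le> a"
  shows "\<bar>integral {a..} f\<bar> \<le> C * exp (-a)"
proof -
  have g: "((\<lambda>x. C * exp (-x)) has_integral C * exp (-a)) {a..}"
    using has_integral_exp_minus_to_infinity[of 1 a] by (auto intro!: has_integral_mult_right)
  have "norm (integral {a..} f) \<le> integral {a..} (\<lambda>x. C * exp (-x))"
  proof (rule integral_norm_bound_integral)
    show "f integrable_on {a..}" by (rule exp_tail_integrable[OF cont bd])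
    show "(\<lambda>x. C * exp (-x)) integrable_on {a..}" using g by blast
  qed (use bd \<open>X \<le> a\<close> in auto)
  also have "\<dots> = C * exp (-a)" by (rule integral_unique[OF g])
  finally show ?thesis by simp
qed

lemma exp_bound_tendsto_0:
  fixes f :: "real \<Rightarrow> real"
  assumes bd: "\<And>x. X \<le> x \<Longrightarrow> \<bar>f x\<bar> \<le> C * exp (-x)"
  shows "(f \<longlongrightarrow> 0) at_top" "((\<lambda>x. x * f x) \<longlongrightarrow> 0) at_top"
proof -
  have e: "((\<lambda>x::real. exp (-x)) \<longlongrightarrow> 0) at_top" "((\<lambda>x::real. x * exp (-x)) \<longlongrightarrow> 0) at_top"
    by real_asymp+
  show "(f \<longlongrightarrow> 0) at_top"
    by (rule Lim_null_comparison[OF _ tendsto_mult_right_zero[OF e(1), of C]])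
       (use bd in \<open>auto simp: eventually_at_top_linorder intro!: exI[of _ X]\<close>)
  show "((\<lambda>x. x * f x) \<longlongrightarrow> 0) at_top"
  proof (rule Lim_null_comparison[OF _ tendsto_mult_right_zero[OF e(2), of C]])
    show "\<forall>\<^sub>F x in at_top. norm (x * f x) \<le> C * (x * exp (-x))"
      using eventually_ge_at_top[of X] eventually_ge_at_top[of 0]
    proof eventually_elim
      case (elim x)
      then show ?case using mult_left_mono[OF bd, of x x] by (simp add: abs_mult mult_ac)
    qed
  qed
qed

text \<open>The set where \<open>f\<close> is at most 0 is closed, so its infimum belongs to it; the
  intermediate value theorem makes \<open>f\<close> vanish there.\<close>

lemma first_zero:
  fixes f :: "real \<Rightarrow> real"
  assumes "a \<le> b" and cont: "continuous_on {a..b} f" and "f a > 0" "f b \<le> 0"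
  obtains c where "a < c" "c \<le> b" "f c = 0" "\<And>t. a \<le> t \<Longrightarrow> t < c \<Longrightarrow> f t > 0"
proof -
  define S where "S = {a..b} \<inter> f -` {..0}"
  have "closed S" unfolding S_def by (rule continuous_closed_preimage[OF cont]) auto
  moreover have "bdd_below S" "S \<noteq> {}" unfolding S_def using assms by auto
  ultimately have "Inf S \<in> S" by (intro closed_contains_Inf)
  then have c: "a \<le> Inf S" "Inf S \<le> b" "f (Inf S) \<le> 0" by (auto simp: S_def)
  have pos: "f t > 0" if "a \<le> t" "t < Inf S" for t
    using that cInf_lower[of t S] \<open>bdd_below S\<close> c by (force simp: S_def)
  have "a \<noteq> Inf S" using c assms by auto
  then have lt: "a < Inf S" using c by simp
  have "f (Inf S) = 0"
  proof (rule ccontr)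
    assume "f (Inf S) \<noteq> 0"
    then have "f (Inf S) < 0" using c by simp
    obtain z where z: "a \<le> z" "z \<le> Inf S" "f z = 0"
      using IVT2'[of f "Inf S" 0 a] c assms
      by (metis atLeastatMost_subset_iff continuous_on_subset less_eq_real_def order_refl)
    then show False using pos[of z] \<open>f (Inf S) < 0\<close> by (cases "z = Inf S") auto
  qed
  with lt c pos show thesis by (intro that[of "Inf S"]) auto
qed

section \<open>The Airy function on the positive axis\<close>

text \<open>Cauchy's theorem for the rectangle over \<open>{0..T}\<close> of height
  \<open>r\<close>, the height of the saddle point. The left side contributes nothing to the real
  part, and the right side gives the error \<open>1 / T^2\<close>.\<close>

lemma airy_integral_shift:
  fixes r T :: real
  assumes "r > 0" "T > 0"
  shows "\<bar>integral {0..T} (\<lambda>t. cos (t ^ 3 / 3 + r\<^sup>2 * t)) -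
    exp (- (2/3) * r ^ 3) * integral {0..T} (\<lambda>t. exp (- r * t\<^sup>2) * cos (t ^ 3 / 3))\<bar> \<le> 1 / T\<^sup>2"
proof -
  define f where "f z = exp (\<i> * (z ^ 3 / 3 + of_real (r\<^sup>2) * z))" for z :: complex
  have "f holomorphic_on UNIV" unfolding f_def by (auto intro!: holomorphic_intros)
  \<comment> \<open>With an entire primitive \<open>P\<close>, the integral along each side is a
    difference of values of \<open>P\<close> at the corners.\<close>
  then obtain P where P: "\<And>z. (P has_field_derivative f z) (at z)"
    using holomorphic_convex_primitive'[of UNIV f] by auto
  have Re3: "Re (z ^ 3) = Re z ^ 3 - 3 * Re z * (Im z)\<^sup>2"
    and Im3: "Im (z ^ 3) = 3 * (Re z)\<^sup>2 * Im z - Im z ^ 3" for z :: complex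
    by (simp_all add: power3_eq_cube power2_eq_square algebra_simps)
  have Ref: "Re (f z) = exp (- (Im (z ^ 3) / 3 + r\<^sup>2 * Im z)) * cos (Re (z ^ 3) / 3 + r\<^sup>2 * Re z)"
    and Imf: "Im (f z) = exp (- (Im (z ^ 3) / 3 + r\<^sup>2 * Im z)) * sin (Re (z ^ 3) / 3 + r\<^sup>2 * Re z)" for z
    unfolding f_def by (simp_all add: Re_exp Im_exp)
  have deriv: "((\<lambda>t. Re (P (c + of_real t * d))) has_real_derivative
      Re (d * f (c + of_real t * d))) (at t within S)" for c d t S
  proof -
    have "((\<lambda>t. c + of_real t * d) has_vector_derivative d) (at t within S)"
      by (auto intro!: derivative_eq_intros)
    then have "(P \<circ> (\<lambda>t. c + of_real t * d) has_vector_derivative d * f (c + of_real t * d))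
        (at t within S)"
      by (rule field_vector_diff_chain_within) (rule has_field_derivative_at_within[OF P])
    from bounded_linear.has_vector_derivative[OF bounded_linear_Re this]
    show ?thesis by (simp add: has_real_derivative_iff_has_vector_derivative o_def)
  qed
  have hor: "((\<lambda>t. Re (f (c + of_real t))) has_integral Re (P (c + of_real T)) - Re (P c)) {0..T}" for c
    using fundamental_theorem_of_calculus[of 0 T "\<lambda>t. Re (P (c + of_real t * 1))" "\<lambda>t. Re (f (c + of_real t))"]
      deriv[of c 1] \<open>T > 0\<close> by (simp add: has_real_derivative_iff_has_vector_derivative)
  have bottom: "integral {0..T} (\<lambda>t. cos (t ^ 3 / 3 + r\<^sup>2 * t)) = Re (P (of_real T)) - Re (P 0)"
    using integral_unique[OF hor[of 0]] by (simp add: Ref Re3 Im3)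
  \<comment> \<open>At height \<open>r\<close> the linear terms of the phase cancel, and a Gaussian
    factor appears.\<close>
  have "Re (f (\<i> * of_real r + of_real t)) = exp (- (2/3) * r ^ 3) * (exp (- r * t\<^sup>2) * cos (t ^ 3 / 3))" for t
  proof -
    have z: "Re (\<i> * of_real r + of_real t) = t" "Im (\<i> * of_real r + of_real t) = r" by simp_all
    have "- ((3 * t\<^sup>2 * r - r ^ 3) / 3 + r\<^sup>2 * r) = - (2/3) * r ^ 3 + - r * t\<^sup>2"
      by (simp add: field_simps power3_eq_cube power2_eq_square)
    moreover have "(t ^ 3 - 3 * t * r\<^sup>2) / 3 + r\<^sup>2 * t = t ^ 3 / 3"
      by (simp add: field_simps)
    ultimately show ?thesis unfolding Ref Re3 Im3 z by (simp only: exp_add mult.assoc)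
  qed
  then have top: "exp (- (2/3) * r ^ 3) * integral {0..T} (\<lambda>t. exp (- r * t\<^sup>2) * cos (t ^ 3 / 3)) =
      Re (P (\<i> * of_real r + of_real T)) - Re (P (\<i> * of_real r))"
    using integral_unique[OF hor[of "\<i> * of_real r"]] by simp
  \<comment> \<open>On the imaginary axis \<open>f\<close> is real, so its product with the
    direction of the side is purely imaginary.\<close>
  have "((\<lambda>t. Re (P (0 + of_real t * \<i>))) has_real_derivative 0) (at t)" for t
  proof -
    have "Re (\<i> * f (0 + of_real t * \<i>)) = 0" by (simp add: Imf Re3)
    then show ?thesis using deriv[of 0 \<i> t UNIV] by simp
  qed
  then have left: "Re (P (0 + of_real r * \<i>)) = Re (P (0 + of_real 0 * \<i>))"
    by (intro DERIV_isconst_all[of "\<lambda>t. Re (P (0 + of_real t * \<i>))"]) simp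
  \<comment> \<open>The majorant is the antiderivative of \<open>exp (- T^2 * s)\<close>. It bounds
    the integrand because \<open>s^3 / 3\<close> is at most \<open>r^2 * s\<close> for
    \<open>s\<close> below \<open>r\<close>.\<close>
  have right: "norm (Re (P (of_real T + of_real r * \<i>)) - Re (P (of_real T + of_real 0 * \<i>)))
      \<le> - exp (- T\<^sup>2 * r) / T\<^sup>2 - - exp (- T\<^sup>2 * 0) / T\<^sup>2"
  proof (rule differentiable_bound_general[OF \<open>r > 0\<close>])
    show "continuous_on {0..r} (\<lambda>s. - exp (- T\<^sup>2 * s) / T\<^sup>2)"
      using \<open>T > 0\<close> by (intro continuous_intros) auto
    show "continuous_on {0..r} (\<lambda>s. Re (P (of_real T + of_real s * \<i>)))"
      by (rule DERIV_continuous_on[OF deriv])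
  next
    fix s assume s: "0 < s" "s < r"
    show "((\<lambda>s. Re (P (of_real T + of_real s * \<i>))) has_vector_derivative
        Re (\<i> * f (of_real T + of_real s * \<i>))) (at s)"
      using deriv[of "of_real T" \<i> s UNIV] by (simp add: has_real_derivative_iff_has_vector_derivative)
    show "((\<lambda>s. - exp (- T\<^sup>2 * s) / T\<^sup>2) has_vector_derivative exp (- T\<^sup>2 * s)) (at s)"
      unfolding has_real_derivative_iff_has_vector_derivative[symmetric]
      using \<open>T > 0\<close> by (auto intro!: derivative_eq_intros simp: power2_eq_square power4_eq_xxxx)
    have "s ^ 3 / 3 \<le> r\<^sup>2 * s"
    proof -
      have "s\<^sup>2 * s \<le> r\<^sup>2 * s" using s by (intro mult_right_mono power_mono) auto
      moreover have "s\<^sup>2 * s \<ge> 0" using s by simp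
      ultimately show ?thesis by (simp add: power3_eq_cube power2_eq_square)
    qed
    then have "exp (- ((3 * T\<^sup>2 * s - s ^ 3) / 3 + r\<^sup>2 * s)) \<le> exp (- T\<^sup>2 * s)" by (simp add: diff_divide_distrib)
    moreover have "norm (Re (\<i> * f z)) \<le> exp (- (Im (z ^ 3) / 3 + r\<^sup>2 * Im z))" for z
      by (simp only: times_complex.sel imaginary_unit.sel Imf)
         (simp add: abs_mult mult_left_le del: exp_le_cancel_iff)
    from this[of "of_real T + of_real s * \<i>"]
    have "norm (Re (\<i> * f (of_real T + of_real s * \<i>))) \<le>
        exp (- ((3 * T\<^sup>2 * s - s ^ 3) / 3 + r\<^sup>2 * s))"
      unfolding Im3 by simp
    ultimately show "norm (Re (\<i> * f (of_real T + of_real s * \<i>))) \<le> exp (- T\<^sup>2 * s)"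
      by linarith
  qed
  have "Re (P (of_real T)) - Re (P 0) - (Re (P (\<i> * of_real r + of_real T)) - Re (P (\<i> * of_real r)))
      = - (Re (P (of_real T + of_real r * \<i>)) - Re (P (of_real T + of_real 0 * \<i>)))"
    using left by (simp add: mult.commute add.commute)
  moreover have "- exp (- T\<^sup>2 * r) / T\<^sup>2 - - exp (- T\<^sup>2 * 0) / T\<^sup>2 \<le> 1 / T\<^sup>2"
    using \<open>T > 0\<close> by (simp add: field_simps)
  ultimately show ?thesis unfolding bottom top using right unfolding real_norm_def by linarith
qed

text \<open>Let \<open>T\<close> tend to infinity in the shifted integral: the error
  \<open>1 / T^2\<close> vanishes and the Gaussian factor gives convergence. This also shows that
  the improper integral exists.\<close>

lemma airy_Ai_eq:
  fixes r :: real
  assumes "r \<ge> 1"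
  shows "airy_Ai (r\<^sup>2) = exp (- (2/3) * r ^ 3) / pi * integral {0..} (\<lambda>t. exp (- r * t\<^sup>2) * cos (t ^ 3 / 3))"
proof -
  define g where "g t = exp (- r * t\<^sup>2) * cos (t ^ 3 / 3)" for t
  define I where "I T = integral {0..T} (\<lambda>t. cos (t ^ 3 / 3 + r\<^sup>2 * t))" for T
  have cont: "continuous_on UNIV g" unfolding g_def by (intro continuous_intros) auto
  have bd: "\<bar>g t\<bar> \<le> 1 * exp (-t)" if "1 \<le> t" for t
  proof -
    have "1 * t \<le> r * t\<^sup>2" using that assms by (intro mult_mono) (auto simp: power2_eq_square)
    then have "exp (- r * t\<^sup>2) \<le> exp (-t)" by simp
    moreover have "\<bar>g t\<bar> \<le> exp (- r * t\<^sup>2)" unfolding g_def by (simp add: abs_mult mult_left_le)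
    ultimately show ?thesis by linarith
  qed
  have "((\<lambda>T. integral {T..} g) \<longlongrightarrow> 0) at_top"
    by (rule exp_bound_tendsto_0(1)) (rule exp_tail_bound[OF cont bd])
  then have "((\<lambda>T. integral {0..} g - integral {T..} g) \<longlongrightarrow> integral {0..} g - 0) at_top"
    by (intro tendsto_intros)
  moreover have "\<forall>\<^sub>F T in at_top. integral {0..} g - integral {T..} g = integral {0..T} g"
    using eventually_ge_at_top[of 0]
  proof eventually_elim
    case (elim T)
    then show ?case using exp_tail_split[of g 1 1 0 T] cont bd by simp
  qed
  ultimately have "((\<lambda>T. integral {0..T} g) \<longlongrightarrow> integral {0..} g) at_top"
    by (simp add: tendsto_cong)
  then have lim: "((\<lambda>T. exp (- (2/3) * r ^ 3) * integral {0..T} g)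
      \<longlongrightarrow> exp (- (2/3) * r ^ 3) * integral {0..} g) at_top"
    by (intro tendsto_intros)
  have "((\<lambda>T::real. 1 / T\<^sup>2) \<longlongrightarrow> 0) at_top" by real_asymp
  then have "((\<lambda>T. I T - exp (- (2/3) * r ^ 3) * integral {0..T} g) \<longlongrightarrow> 0) at_top"
  proof (rule Lim_null_comparison[rotated])
    show "\<forall>\<^sub>F T in at_top. norm (I T - exp (- (2/3) * r ^ 3) * integral {0..T} g) \<le> 1 / T\<^sup>2"
      using eventually_gt_at_top[of 0]
    proof eventually_elim
      case (elim T)
      then show ?case using airy_integral_shift[of r T] assms unfolding I_def g_def by simp
    qed
  qed
  from tendsto_add[OF this lim] have "(I \<longlongrightarrow> exp (- (2/3) * r ^ 3) * integral {0..} g) at_top" by simp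
  then have "Lim at_top I = exp (- (2/3) * r ^ 3) * integral {0..} g"
    by (intro tendsto_Lim) auto
  then show ?thesis unfolding airy_Ai_def I_def g_def by simp
qed

text \<open>With \<open>r = sqrt x\<close>, at least 3, the part over \<open>{0..1}\<close> is at
  least \<open>exp (-r) / 2\<close>, since the cosine is at least 1/2 there, and outweighs the tail,
  at most \<open>exp (-r) / 3\<close>. For the upper bound the integral is at most 2, which is less
  than \<open>pi\<close>.\<close>

lemma airy_Ai_bounds:
  assumes "x \<ge> 9"
  shows "0 < airy_Ai x" "airy_Ai x \<le> exp (-x)"
proof -
  define r where "r = sqrt x"
  have r: "r \<ge> 3" "x = r\<^sup>2" using assms by (auto simp: r_def real_le_rsqrt)
  define g where "g t = exp (- r * t\<^sup>2) * cos (t ^ 3 / 3)" for t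
  have cont: "continuous_on S g" for S unfolding g_def by (intro continuous_intros) auto
  have g1: "\<bar>g t\<bar> \<le> exp (- r * t\<^sup>2)" for t unfolding g_def by (simp add: abs_mult mult_left_le)
  have g2: "\<bar>g t\<bar> \<le> exp (- r * t)" if "1 \<le> t" for t
  proof -
    have "r * t \<le> r * t\<^sup>2" using that r by (intro mult_left_mono) (auto simp: power2_eq_square)
    then show ?thesis using g1[of t] by (smt (verit) exp_le_cancel_iff mult_minus_left)
  qed
  have bd: "\<bar>g t\<bar> \<le> 1 * exp (-t)" if "1 \<le> t" for t
  proof -
    have "1 * t \<le> r * t" using that r by (intro mult_right_mono) auto
    then show ?thesis using g2[OF that] by (smt (verit) exp_le_cancel_iff mult_minus_left)
  qed
  have split: "integral {0..} g = integral {0..1} g + integral {1..} g"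
    using exp_tail_split[of g 1 1 0 1] cont bd by simp
  have E: "((\<lambda>t. exp (- r * t)) has_integral exp (- r) / r) {1..}"
    using has_integral_exp_minus_to_infinity[of r 1] r by simp
  have "norm (integral {1..} g) \<le> integral {1..} (\<lambda>t. exp (- r * t))"
  proof (rule integral_norm_bound_integral)
    show "g integrable_on {1..}" by (rule exp_tail_integrable[OF cont bd])
    show "(\<lambda>t. exp (- r * t)) integrable_on {1..}" using E by blast
  qed (use g2 in auto)
  then have tail: "\<bar>integral {1..} g\<bar> \<le> exp (- r) / r" using integral_unique[OF E] by simp
  have gi: "g integrable_on {0..1}" by (rule integrable_continuous_interval[OF cont])
  have "integral {0..1} g \<le> integral {0..1} (\<lambda>_::real. 1::real)"
  proof (rule integral_le[OF gi])
    fix t :: real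
    have "exp (- r * t\<^sup>2) \<le> 1" using r by simp
    then show "g t \<le> 1" using g1[of t] by linarith
  qed auto
  then have up: "integral {0..1} g \<le> 1" by simp
  have "integral {0..1} (\<lambda>_::real. exp (-r) / 2) \<le> integral {0..1} g"
  proof (rule integral_le[OF _ gi])
    fix t :: real assume t: "t \<in> {0..1}"
    have "t\<^sup>2 \<le> 1" "t ^ 3 \<le> 1" "0 \<le> t ^ 3" using t by (auto simp: power_le_one)
    then have "cos (pi / 3) \<le> cos (t ^ 3 / 3)" using pi_gt3 by (intro cos_monotone_0_pi_le) auto
    then have c: "1 / 2 \<le> cos (t ^ 3 / 3)" by (simp add: cos_60)
    have "r * t\<^sup>2 \<le> r" using \<open>t\<^sup>2 \<le> 1\<close> r by (simp add: mult_left_le)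
    then have "exp (-r) \<le> exp (- r * t\<^sup>2)" by simp
    then have "exp (-r) * (1/2) \<le> exp (- r * t\<^sup>2) * cos (t ^ 3 / 3)" using c by (intro mult_mono) auto
    then show "exp (-r) / 2 \<le> g t" by (simp add: g_def)
  qed auto
  then have low: "exp (-r) / 2 \<le> integral {0..1} g" by simp
  have "exp (-r) / r \<le> exp (-r) / 3" using r by (intro divide_left_mono) auto
  then have pos: "0 < integral {0..} g" and le: "integral {0..} g \<le> 2"
    using split tail up low exp_gt_zero[of "-r"] exp_le_one_iff[of "-r"] r by linarith+
  have Ai: "airy_Ai x = exp (- (2/3) * r ^ 3) / pi * integral {0..} g"
    using airy_Ai_eq[of r] r unfolding g_def by simp
  then show "0 < airy_Ai x" using pos by simp
  have "r\<^sup>2 * 3 \<le> r\<^sup>2 * r" using r by (intro mult_left_mono) auto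
  then have "exp (- (2/3) * r ^ 3) \<le> exp (-x)" using r by (simp add: power3_eq_cube power2_eq_square)
  then have "airy_Ai x \<le> exp (-x) / pi * 2" unfolding Ai
    using pos le by (intro mult_mono divide_right_mono) auto
  also have "\<dots> \<le> exp (-x)" using pi_gt3 by (simp add: field_simps)
  finally show "airy_Ai x \<le> exp (-x)" .
qed

section \<open>Reflections, extremal zeros and a blow-up criterion\<close>

lemma DERIV_reflect:
  fixes f :: "real \<Rightarrow> real"
  assumes "\<And>x. (f has_real_derivative f' x) (at x)"
  shows "((\<lambda>t. f (a - t)) has_real_derivative - f' (a - t)) (at t)"
proof -
  have "((\<lambda>t. a - t) has_real_derivative - 1) (at t)" by (rule derivative_eq_intros refl | simp)+
  from DERIV_chain2[OF assms this] show ?thesis by simp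
qed

lemma DERIV_translate:
  fixes f :: "real \<Rightarrow> real"
  assumes "\<And>x. (f has_real_derivative f' x) (at x)"
  shows "((\<lambda>t. f (a + t)) has_real_derivative f' (a + t)) (at t)"
proof -
  have "((\<lambda>t. a + t) has_real_derivative 1) (at t)" by (rule derivative_eq_intros refl | simp)+
  from DERIV_chain2[OF assms this] show ?thesis by simp
qed

text \<open>A positive derivative at the first zero would make \<open>f\<close> negative just before
  it. Barrier arguments use this by contradicting the sign of \<open>f'\<close> at the zero.\<close>

lemma first_zero_deriv:
  fixes f :: "real \<Rightarrow> real"
  assumes f: "\<And>x. (f has_real_derivative f' x) (at x)" and "a \<le> b" "f a > 0" "f b \<le> 0"
  shows "\<exists>c. a < c \<and> c \<le> b \<and> f c = 0 \<and> f' c \<le> 0 \<and> (\<forall>t. a \<le> t \<longrightarrow> t < c \<longrightarrow> f t > 0)"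
proof -
  have "continuous_on {a..b} f" by (rule DERIV_continuous_on) (rule has_field_derivative_at_within[OF f])
  then obtain c where c: "a < c" "c \<le> b" "f c = 0" "\<And>t. a \<le> t \<Longrightarrow> t < c \<Longrightarrow> f t > 0"
    using first_zero[of a b f] assms by metis
  have "f' c \<le> 0"
  proof (rule ccontr)
    assume "\<not> f' c \<le> 0"
    then obtain d where d: "d > 0" "\<And>h. 0 < h \<Longrightarrow> h < d \<Longrightarrow> f (c - h) < f c"
      using DERIV_pos_inc_left[OF f, of c] by auto
    then have "f (c - min (d / 2) (c - a)) < 0" using c(1,3) d(2)[of "min (d / 2) (c - a)"] by auto
    moreover have "f (c - min (d / 2) (c - a)) > 0" using c(1) d(1) by (intro c(4)) auto
    ultimately show False by simp
  qed
  with c show ?thesis by blast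
qed

lemma last_zero_deriv:
  fixes f :: "real \<Rightarrow> real"
  assumes f: "\<And>x. (f has_real_derivative f' x) (at x)" and "a \<le> b" "f a \<le> 0" "f b > 0"
  shows "\<exists>c. a \<le> c \<and> c < b \<and> f c = 0 \<and> f' c \<ge> 0 \<and> (\<forall>t. c < t \<longrightarrow> t \<le> b \<longrightarrow> f t > 0)"
proof -
  have "((\<lambda>x. f (- x)) has_real_derivative - f' (- x)) (at x)" for x
    using DERIV_reflect[of f f' 0] f by simp
  from first_zero_deriv[OF this, of "- b" "- a"] assms
  obtain c where c: "- b < c" "c \<le> - a" "f (- c) = 0" "- f' (- c) \<le> 0"
    "\<forall>t. - b \<le> t \<longrightarrow> t < c \<longrightarrow> f (- t) > 0"
    by fastforce
  have "f t > 0" if "- c < t" "t \<le> b" for t using c(5)[rule_format, of "- t"] that by simp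
  with c show ?thesis by (intro exI[of _ "- c"]) simp
qed

lemma DERIV_inverse_sqrt:
  "0 < (x::real) \<Longrightarrow> ((\<lambda>x. 1 / sqrt x) has_real_derivative - 1 / (2 * (x * sqrt x))) (at x)"
  by (rule derivative_eq_intros refl | simp add: divide_simps)+

text \<open>The energy \<open>Q\<close> is nondecreasing and \<open>z\<close> grows at least
  linearly, so eventually \<open>z'\<close> is at least \<open>z * sqrt z / 2\<close>. Then
  \<open>1 / sqrt z\<close> falls at rate at least 1/4 and would become negative in finite
  time.\<close>

lemma superquadratic_blow_up:
  fixes z z' z'' :: "real \<Rightarrow> real"
  assumes z: "\<And>s. (z has_real_derivative z' s) (at s)"
    and z': "\<And>s. (z' has_real_derivative z'' s) (at s)"
    and sq: "\<And>s. s \<ge> s0 \<Longrightarrow> (z s)\<^sup>2 \<le> z'' s"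
    and one: "\<And>s. s \<ge> s0 \<Longrightarrow> 1 \<le> z s"
    and slope: "\<And>s. s \<ge> s0 \<Longrightarrow> \<mu> \<le> z' s" and "\<mu> > 0"
  shows False
proof -
  define Q where "Q s = (z' s)\<^sup>2 - (2/3) * (z s) ^ 3" for s
  have Q: "(Q has_real_derivative 2 * z' s * (z'' s - (z s)\<^sup>2)) (at s)" for s
    unfolding Q_def by (rule derivative_eq_intros z z' refl | simp add: algebra_simps)+
  have Qmono: "Q s0 \<le> Q s" if "s \<ge> s0" for s
  proof (rule DERIV_nonneg_imp_nondecreasing[OF that])
    fix x assume "s0 \<le> x"
    then have "2 * z' x * (z'' x - (z x)\<^sup>2) \<ge> 0"
      using slope[of x] \<open>\<mu> > 0\<close> sq[of x] by (intro mult_nonneg_nonneg) auto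
    then show "\<exists>y. DERIV Q x :> y \<and> y \<ge> 0" using Q by blast
  qed
  have lin: "z s \<ge> \<mu> * (s - s0)" if "s \<ge> s0" for s
  proof -
    have "z s0 - \<mu> * s0 \<le> z s - \<mu> * s"
    proof (rule DERIV_nonneg_imp_nondecreasing[OF that])
      fix x assume "s0 \<le> x"
      moreover have "((\<lambda>s. z s - \<mu> * s) has_real_derivative z' x - \<mu>) (at x)"
        by (rule derivative_eq_intros z refl | simp)+
      ultimately show "\<exists>y. DERIV (\<lambda>s. z s - \<mu> * s) x :> y \<and> y \<ge> 0" using slope by fastforce
    qed
    then show ?thesis using one[of s0] by (simp add: algebra_simps)
  qed
  \<comment> \<open>From \<open>s1\<close> on, \<open>z\<close> is at least
    \<open>3 * \<bar>Q s0\<bar>\<close>, so a negative \<open>Q\<close> costs at most a third of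
    \<open>z^3\<close>, and the remaining third exceeds the quarter that is claimed.\<close>
  define s1 where "s1 = s0 + 3 * \<bar>Q s0\<bar> / \<mu>"
  have s1: "s1 \<ge> s0" using \<open>\<mu> > 0\<close> by (simp add: s1_def)
  have fast: "z s * sqrt (z s) / 2 \<le> z' s" if "s \<ge> s1" for s
  proof -
    have s: "s \<ge> s0" using that s1 by simp
    have "3 * \<bar>Q s0\<bar> \<le> \<mu> * (s - s0)" using that \<open>\<mu> > 0\<close> by (simp add: s1_def field_simps)
    then have "3 * \<bar>Q s0\<bar> \<le> z s" using lin[OF s] by simp
    also have "\<dots> \<le> (z s) ^ 3" using one[OF s] by (simp add: self_le_power)
    finally have "3 * \<bar>Q s0\<bar> \<le> (z s) ^ 3" .
    moreover have "(z' s)\<^sup>2 = Q s + (2/3) * (z s) ^ 3" by (simp add: Q_def)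
    moreover have "(z s) ^ 3 \<ge> 0" using one[OF s] by simp
    ultimately have "(z s) ^ 3 / 4 \<le> (z' s)\<^sup>2" using Qmono[OF s] by linarith
    moreover have "(z s * sqrt (z s) / 2)\<^sup>2 = (z s) ^ 3 / 4"
      using one[OF s] by (simp add: power_mult_distrib power_divide)
        (simp add: power3_eq_cube power2_eq_square)
    ultimately have "(z s * sqrt (z s) / 2)\<^sup>2 \<le> (z' s)\<^sup>2" by simp
    moreover have "0 \<le> z' s" using slope[OF s] \<open>\<mu> > 0\<close> by simp
    ultimately show ?thesis by (rule power2_le_imp_le)
  qed
  define h where "h s = 1 / sqrt (z s)" for s
  \<comment> \<open>Over a length of 8 the function \<open>h\<close> drops by at least 2, although
    it starts at most at 1 and stays nonnegative.\<close>
  have "h (s1 + 8) + (s1 + 8) / 4 \<le> h s1 + s1 / 4"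
  proof (rule DERIV_nonpos_imp_nonincreasing[where f = "\<lambda>s. h s + s / 4"])
    fix x assume "s1 \<le> x"
    then have p: "z x \<ge> 1" using one[of x] s1 by simp
    have "((\<lambda>s. 1 / sqrt (z s)) has_real_derivative - z' x / (2 * (z x * sqrt (z x)))) (at x)"
      using DERIV_chain2[OF DERIV_inverse_sqrt z, of x] p by simp
    then have "((\<lambda>s. h s + s / 4) has_real_derivative - z' x / (2 * (z x * sqrt (z x))) + 1 / 4) (at x)"
      unfolding h_def by (intro DERIV_add DERIV_cdivide DERIV_ident)
    moreover have "- z' x / (2 * (z x * sqrt (z x))) + 1 / 4 \<le> 0"
      using fast[OF \<open>s1 \<le> x\<close>] p by (simp add: field_simps)
    ultimately show "\<exists>y. DERIV (\<lambda>s. h s + s / 4) x :> y \<and> y \<le> 0" by blast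
  qed simp
  moreover have "h s1 \<le> 1" using one[OF s1] by (simp add: h_def)
  moreover have "h (s1 + 8) \<ge> 0" using one[of "s1 + 8"] s1 by (simp add: h_def)
  ultimately have "h (s1 + 8) + s1 / 4 + 2 \<le> 1 + s1 / 4" "0 \<le> h (s1 + 8)" by (simp_all add: add_divide_distrib)
  then show False by linarith
qed

section \<open>Decaying solutions of Painleve II: tails, decay of the derivative, energy\<close>

locale decaying_painleve_II =
  fixes u u' :: "real \<Rightarrow> real" and C X :: real
  assumes du: "(u has_real_derivative u' x) (at x)"
    and du': "(u' has_real_derivative 2 * u x ^ 3 + x * u x) (at x)"
    and neg: "X \<le> x \<Longrightarrow> u x < 0"
    and decay: "X \<le> x \<Longrightarrow> \<bar>u x\<bar> \<le> C * exp (- x)"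
    and X: "X \<ge> 1"
begin

text \<open>Half of \<open>S\<close> and half of \<open>V\<close> are the logarithms of the factors
  \<open>E\<close> and \<open>F\<close>.\<close>

definition "S x = integral {x..} u"
definition "v x = - integral {x..} (\<lambda>s. (u s)\<^sup>2)"
definition "V x = integral {x..} v"
definition "y x = x + 2 * u' x + 2 * (u x)\<^sup>2"

lemma cont_u: "continuous_on A u"
  by (rule DERIV_continuous_on) (rule has_field_derivative_at_within[OF du])

lemma u_tendsto: "(u \<longlongrightarrow> 0) at_top"
  by (rule exp_bound_tendsto_0(1)[OF decay])

lemma dS: "(S has_real_derivative - u x) (at x)"
  unfolding S_def by (rule exp_tail_has_derivative[OF cont_u decay])

lemma S_tendsto: "(S \<longlongrightarrow> 0) at_top"
  unfolding S_def by (rule exp_bound_tendsto_0(1)) (rule exp_tail_bound[OF cont_u decay])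

lemma usq_decay: "X \<le> x \<Longrightarrow> \<bar>(u x)\<^sup>2\<bar> \<le> C\<^sup>2 * exp (- x)"
proof -
  assume x: "X \<le> x"
  have "(u x)\<^sup>2 \<le> (C * exp (- x))\<^sup>2"
    using power_mono[OF decay[OF x], of 2] by simp
  also have "\<dots> = C\<^sup>2 * (exp (- x) * exp (- x))" by (simp add: power2_eq_square)
  also have "\<dots> \<le> C\<^sup>2 * (exp (- x) * 1)" using X x by (intro mult_left_mono) auto
  finally show ?thesis by simp
qed

lemma cont_usq: "continuous_on A (\<lambda>x. (u x)\<^sup>2)"
  by (intro continuous_intros cont_u)

lemma dv: "(v has_real_derivative (u x)\<^sup>2) (at x)"
  unfolding v_def using DERIV_minus[OF exp_tail_has_derivative[OF cont_usq usq_decay]] by simp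

lemma v_decay: "X \<le> x \<Longrightarrow> \<bar>v x\<bar> \<le> C\<^sup>2 * exp (- x)"
  unfolding v_def using exp_tail_bound[OF cont_usq usq_decay] by simp

lemma cont_v: "continuous_on A v"
  by (rule DERIV_continuous_on) (rule has_field_derivative_at_within[OF dv])

lemma dV: "(V has_real_derivative - v x) (at x)"
  unfolding V_def by (rule exp_tail_has_derivative[OF cont_v v_decay])

lemma V_tendsto: "(V \<longlongrightarrow> 0) at_top"
  unfolding V_def by (rule exp_bound_tendsto_0(1)) (rule exp_tail_bound[OF cont_v v_decay])

lemma v_neg: "v x < 0"
proof -
  have "v x \<le> v (max x X)"
    by (rule DERIV_nonneg_imp_nondecreasing) (auto intro: dv)
  also have "\<dots> < v (max x X + 1)"
  proof (rule DERIV_pos_imp_increasing[where f = v])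
    fix t assume "max x X \<le> t"
    then have "(u t)\<^sup>2 > 0" using neg[of t] by simp
    then show "\<exists>l. DERIV v t :> l \<and> l > 0" using dv by blast
  qed simp
  also have "\<dots> \<le> 0"
    unfolding v_def using integral_nonneg[OF exp_tail_integrable[OF cont_usq usq_decay]] by simp
  finally show ?thesis .
qed

lemma V_neg: "V x \<le> 0"
proof -
  have "0 \<le> integral {x..} (\<lambda>t. - v t)"
    by (rule integral_nonneg[OF integrable_neg[OF exp_tail_integrable[OF cont_v v_decay]]])
       (use v_neg in \<open>auto intro: less_imp_le\<close>)
  then show ?thesis by (simp add: V_def)
qed

text \<open>Such a \<open>u\<close> would stay below \<open>u a < 0\<close> and could not tend to
  0.\<close>

lemma not_nonincreasing:
  assumes "u a < 0" "\<And>x. a \<le> x \<Longrightarrow> u' x \<le> 0"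
  shows False
proof -
  have "u x \<le> u a" if "a \<le> x" for x
    by (rule DERIV_nonpos_imp_nonincreasing[OF that]) (use du assms in blast)
  then have "0 \<le> u a"
    by (intro tendsto_upperbound[OF u_tendsto]) (auto simp: eventually_at_top_linorder intro!: exI[of _ a])
  then show False using assms by simp
qed

text \<open>The equation reads \<open>u'' = u * (2 * u^2 + x)\<close>, so \<open>u\<close> is
  concave where \<open>u\<close> is nonpositive and \<open>x\<close> nonnegative.\<close>

lemma concave:
  assumes "0 \<le> a" "a \<le> b" "\<And>x. a \<le> x \<Longrightarrow> u x \<le> 0"
  shows "u' b \<le> u' a"
proof (rule DERIV_nonpos_imp_nonincreasing[OF \<open>a \<le> b\<close>])
  fix x assume "a \<le> x"
  then have "u x * (2 * (u x)\<^sup>2 + x) \<le> 0"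
    using assms by (intro mult_nonpos_nonneg) auto
  moreover have "u x * (2 * (u x)\<^sup>2 + x) = 2 * u x ^ 3 + x * u x"
    by (simp add: algebra_simps power3_eq_cube power2_eq_square)
  ultimately show "\<exists>l. DERIV u' x :> l \<and> l \<le> 0" using du' by metis
qed

text \<open>Beyond \<open>X\<close> the solution is negative, concave and increasing, so
  \<open>u' x\<close> is at most the increment of \<open>u\<close> over \<open>{x-1..x}\<close>,
  hence at most the absolute value of \<open>u (x - 1)\<close>. The unit shift produces the factor
  \<open>exp 1\<close>.\<close>

lemma du_decay:
  assumes "X + 1 \<le> x"
  shows "\<bar>u' x\<bar> \<le> (C * exp 1) * exp (- x)"
proof -
  have mono: "u' b \<le> u' a" if "X \<le> a" "a \<le> b" for a b
    using that X neg by (intro concave) (auto intro: less_imp_le)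
  have "u' x > 0"
  proof (rule ccontr)
    assume "\<not> u' x > 0"
    then show False
      using assms mono[of x] by (intro not_nonincreasing[of x] neg) (use mono[of x] assms in \<open>force+\<close>)
  qed
  moreover obtain t where t: "x - 1 < t" "t < x" "u x - u (x - 1) = (x - (x - 1)) * u' t"
    using MVT2[of "x - 1" x u u'] du by auto
  moreover have "u' x \<le> u' t" using assms t by (intro mono) auto
  moreover have "u x < 0" using assms by (intro neg) auto
  ultimately have "\<bar>u' x\<bar> \<le> \<bar>u (x - 1)\<bar>" by simp
  also have "\<dots> \<le> C * exp (- (x - 1))" using assms by (intro decay) auto
  also have "exp (- (x - 1)) = exp 1 * exp (- x)" by (simp flip: exp_add)
  finally show ?thesis by simp
qed

lemma du_tendsto: "(u' \<longlongrightarrow> 0) at_top"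
  by (rule exp_bound_tendsto_0(1)[OF du_decay])

text \<open>By the equation the difference \<open>K\<close> of the two sides is constant, and every
  term of it tends to 0 at infinity.\<close>

lemma energy: "v x = u x ^ 4 + x * (u x)\<^sup>2 - (u' x)\<^sup>2"
proof -
  define K where "K x = (u' x)\<^sup>2 - u x ^ 4 - x * (u x)\<^sup>2 + v x" for x
  have "(K has_real_derivative 0) (at x)" for x
    unfolding K_def
    by (rule derivative_eq_intros du du' dv refl
        | simp add: algebra_simps power4_eq_xxxx power3_eq_cube power2_eq_square)+
  then have const: "K z = K x" for z by (intro DERIV_isconst_all) simp
  have "(v \<longlongrightarrow> 0) at_top" by (rule exp_bound_tendsto_0(1)[OF v_decay])
  moreover have "((\<lambda>x. x * (u x)\<^sup>2) \<longlongrightarrow> 0) at_top" by (rule exp_bound_tendsto_0(2)[OF usq_decay])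
  ultimately have "(K \<longlongrightarrow> 0\<^sup>2 - 0 ^ 4 - 0 + 0) at_top"
    unfolding K_def by (intro tendsto_intros u_tendsto du_tendsto)
  moreover have "K = (\<lambda>_. K x)" by (rule ext) (rule const)
  ultimately have "((\<lambda>_::real. K x) \<longlongrightarrow> 0) at_top" by simp
  then have "K x = 0" by (simp add: tendsto_const_iff)
  then show ?thesis by (simp add: K_def)
qed

section \<open>Negativity of the tail integral of \<open>u\<close>\<close>

text \<open>At a zero of \<open>u\<close> the energy identity gives \<open>v = - u'^2\<close>, while
  \<open>v\<close> is negative.\<close>

lemma du_nonzero: "u x = 0 \<Longrightarrow> u' x \<noteq> 0"
  using energy[of x] v_neg[of x] by auto

text \<open>The Wronskian \<open>D\<close> of \<open>w t = - u (a + t)\<close> and \<open>z t = u (a - t)\<close> satisfies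
  \<open>D' = 2 w z (t + w\<^sup>2 - z\<^sup>2)\<close>. Since \<open>w\<close> and \<open>z\<close> have the same slope at 0, \<open>z\<close> is scaled by
  \<open>1 - \<kappa>\<close> to have a strict inequality to start from.\<close>

lemma lobe_comparison:
  assumes "u a = 0" "u' a < 0" and pos: "\<And>t. 0 < t \<Longrightarrow> t < L \<Longrightarrow> u (a - t) > 0"
    and t1: "0 < t1" "t1 < L"
  shows "u (a - t1) \<le> - u (a + t1)"
proof (rule ccontr)
  define w w' z z' where "w t = - u (a + t)" and "w' t = - u' (a + t)"
    and "z t = u (a - t)" and "z' t = - u' (a - t)" for t
  assume "\<not> u (a - t1) \<le> - u (a + t1)"
  then have less: "w t1 < z t1" by (simp add: w_def z_def)
  have "L > 0" using t1 by simp
  have zpos: "z t > 0" if "0 < t" "t < L" for t using pos that by (simp add: z_def)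
  have dw: "(w has_real_derivative w' t) (at t)" for t
    unfolding w_def w'_def by (intro DERIV_minus DERIV_translate du)
  have dw': "(w' has_real_derivative 2 * w t ^ 3 + (a + t) * w t) (at t)" for t
    unfolding w_def w'_def using DERIV_minus[OF DERIV_translate[OF du']] by simp
  have dz: "(z has_real_derivative z' t) (at t)" for t
    unfolding z_def z'_def by (intro DERIV_reflect du)
  have dz': "(z' has_real_derivative 2 * z t ^ 3 + (a - t) * z t) (at t)" for t
    unfolding z_def z'_def using DERIV_minus[OF DERIV_reflect[OF du', of a t]] by (simp add: algebra_simps)
  have z0: "z 0 = 0" "w 0 = 0" "z' 0 = w' 0" "w' 0 > 0"
    using assms(1,2) by (auto simp: w_def z_def w'_def z'_def)
  have "continuous_on {0..L} z'"
    by (rule DERIV_continuous_on) (rule has_field_derivative_at_within[OF dz'])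
  then have "compact (z' ` {0..L})" by (rule compact_continuous_image) simp
  then obtain B where B: "\<And>t. 0 \<le> t \<Longrightarrow> t \<le> L \<Longrightarrow> \<bar>z' t\<bar> \<le> B"
    using compact_imp_bounded bounded_iff by (metis (no_types, lifting) atLeastAtMost_iff image_eqI real_norm_def)
  have zB: "(z t)\<^sup>2 \<le> B\<^sup>2 * L * t" if t: "0 < t" "t < L" for t
  proof -
    obtain s where s: "0 < s" "s < t" "z t - z 0 = (t - 0) * z' s"
      using MVT2[of 0 t z z'] dz t by auto
    have "\<bar>z t\<bar> \<le> B * t" using s B[of s] t z0 by (simp add: abs_mult mult.commute)
    then have "(z t)\<^sup>2 \<le> (B * t)\<^sup>2" using power_mono[of "\<bar>z t\<bar>" "B * t" 2] by simp
    also have "\<dots> = B\<^sup>2 * t * t" by (simp add: power2_eq_square)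
    also have "\<dots> \<le> B\<^sup>2 * L * t" using t by (intro mult_right_mono mult_left_mono) auto
    finally show ?thesis .
  qed
  \<comment> \<open>The first bound keeps the loss \<open>2 * \<kappa> * z^2\<close> below
    \<open>t\<close>, so that \<open>D' > 0\<close>. The second, positive because
    \<open>w t1 < z t1\<close>, makes \<eta> nonpositive at \<open>t1\<close>, so \<eta> has a zero
    by then.\<close>
  define \<kappa> where "\<kappa> = min (1 / (2 * (B\<^sup>2 * L + 1))) ((z t1 - w t1) / z t1)"
  have BL: "B\<^sup>2 * L \<ge> 0" using \<open>L > 0\<close> by simp
  have \<kappa>: "\<kappa> > 0" "\<kappa> \<le> 1 / (2 * (B\<^sup>2 * L + 1))" "\<kappa> \<le> (z t1 - w t1) / z t1"
    using less zpos[OF t1] BL by (auto simp: \<kappa>_def)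
  have "\<kappa> * (2 * (B\<^sup>2 * L + 1)) \<le> 1" using \<kappa>(2) BL by (simp add: field_simps)
  then have \<kappa>B: "2 * \<kappa> * (B\<^sup>2 * L) < 1" and \<kappa>1: "\<kappa> < 1"
    using \<kappa>(1) BL mult_nonneg_nonneg[of \<kappa> "B\<^sup>2 * L"] by (simp_all add: algebra_simps)
  define \<eta> where "\<eta> t = w t - (1 - \<kappa>) * z t" for t
  have d\<eta>: "(\<eta> has_real_derivative w' t - (1 - \<kappa>) * z' t) (at t)" for t
    unfolding \<eta>_def by (rule derivative_eq_intros dw dz refl | simp)+
  have "w' 0 - (1 - \<kappa>) * z' 0 > 0" using z0 \<kappa>(1) by (simp add: algebra_simps)
  then obtain \<epsilon> where \<epsilon>: "\<epsilon> > 0" "\<And>h. 0 < h \<Longrightarrow> h < \<epsilon> \<Longrightarrow> \<eta> h > 0"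
    using DERIV_pos_inc_right[OF d\<eta>, of 0] z0 by (auto simp: \<eta>_def)
  have "\<eta> t1 \<le> 0" using \<kappa>(3) zpos[OF t1] by (simp add: \<eta>_def field_simps)
  define p where "p = min \<epsilon> t1 / 2"
  have p: "0 < p" "p < \<epsilon>" "p < t1" using \<epsilon>(1) t1 by (auto simp: p_def)
  obtain t0 where t0: "p < t0" "t0 \<le> t1" "\<eta> t0 = 0" "w' t0 - (1 - \<kappa>) * z' t0 \<le> 0"
    "\<And>t. p \<le> t \<Longrightarrow> t < t0 \<Longrightarrow> \<eta> t > 0"
    using first_zero_deriv[OF d\<eta>, of p t1] p \<epsilon>(2)[of p] \<open>\<eta> t1 \<le> 0\<close> by (metis less_imp_le)
  have \<eta>pos: "\<eta> t > 0" if "0 < t" "t < t0" for t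
    using \<epsilon>(2)[of t] t0(5)[of t] that p by (cases "t < p") auto
  define D where "D t = w' t * z t - w t * z' t" for t
  have dD: "(D has_real_derivative 2 * w t * z t * (t + (w t)\<^sup>2 - (z t)\<^sup>2)) (at t)" for t
    unfolding D_def
    by (rule derivative_eq_intros dw dz dw' dz' refl
        | simp add: algebra_simps power3_eq_cube power2_eq_square)+
  have "D 0 < D t0"
  proof (rule DERIV_pos_imp_increasing_open[where f = D])
    show "0 < t0" using p t0 by simp
    show "continuous_on {0..t0} D"
      by (rule DERIV_continuous_on) (rule has_field_derivative_at_within[OF dD])
    fix t assume t: "0 < t" "t < t0"
    then have tL: "t < L" using t0 t1 by simp
    have z: "z t > 0" using zpos t tL by simp
    have wz: "w t > (1 - \<kappa>) * z t" using \<eta>pos[OF t] by (simp add: \<eta>_def)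
    then have w: "w t > 0" using \<kappa>1 z by (smt (verit) mult_pos_pos)
    have "((1 - \<kappa>) * z t)\<^sup>2 \<le> (w t)\<^sup>2" using wz \<kappa>1 z by (intro power_mono) auto
    moreover have "((1 - \<kappa>) * z t)\<^sup>2 = (z t)\<^sup>2 - 2 * \<kappa> * (z t)\<^sup>2 + \<kappa>\<^sup>2 * (z t)\<^sup>2"
      by (simp add: power2_eq_square algebra_simps)
    moreover have "\<kappa>\<^sup>2 * (z t)\<^sup>2 \<ge> 0" by simp
    moreover have "2 * \<kappa> * (z t)\<^sup>2 \<le> 2 * \<kappa> * (B\<^sup>2 * L * t)"
      using zB[OF t(1) tL] \<kappa>(1) by (intro mult_left_mono) auto
    moreover have "2 * \<kappa> * (B\<^sup>2 * L * t) < t" using mult_strict_right_mono[OF \<kappa>B t(1)] by (simp add: mult_ac)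
    ultimately have "t + (w t)\<^sup>2 - (z t)\<^sup>2 > 0" by linarith
    then show "\<exists>l. DERIV D t :> l \<and> l > 0" using dD w z by (metis mult_pos_pos zero_less_numeral)
  qed
  moreover have "D 0 = 0" using z0 by (simp add: D_def)
  \<comment> \<open>Where \<eta> vanishes, \<open>D\<close> is \<open>z\<close> times the derivative
    of \<eta>, which is nonpositive at a first zero. This contradicts the growth of \<open>D\<close>
    from 0.\<close>
  moreover have "D t0 = z t0 * (w' t0 - (1 - \<kappa>) * z' t0)"
  proof -
    have "w t0 = (1 - \<kappa>) * z t0" using t0(3) by (simp add: \<eta>_def)
    show ?thesis unfolding D_def \<open>w t0 = (1 - \<kappa>) * z t0\<close> by (simp add: algebra_simps)
  qed
  moreover have "\<dots> \<le> 0" using t0 p t1 zpos[of t0] by (intro mult_nonneg_nonpos) auto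
  ultimately show False by simp
qed

text \<open>If not, let \<open>c\<close> be the last zero of \<open>S\<close>. Then \<open>u\<close>
  is positive from just after \<open>c\<close> up to its next zero \<open>a\<close>. Reflected in
  \<open>a\<close>, this lobe is dominated by \<open>- u\<close> on the other side, so
  \<open>S c\<close> is at most \<open>S (2 * a - c)\<close>, which is negative.\<close>

lemma S_neg: "S x < 0"
proof (rule ccontr)
  have late: "S t < 0" if "X \<le> t" for t
  proof -
    have "S t < S (t + 1)"
    proof (rule DERIV_pos_imp_increasing[where f = S])
      fix s assume "t \<le> s"
      then have "- u s > 0" using neg[of s] that by simp
      then show "\<exists>l. DERIV S s :> l \<and> l > 0" using dS by blast
    qed simp
    also have "0 \<le> integral {t + 1..} (\<lambda>s. - u s)"
      by (rule integral_nonneg[OF integrable_neg[OF exp_tail_integrable[OF cont_u decay]]])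
         (use that in \<open>auto intro!: less_imp_le neg\<close>)
    then have "S (t + 1) \<le> 0" by (simp add: S_def)
    finally show ?thesis .
  qed
  assume "\<not> S x < 0"
  define b where "b = max x X"
  have b: "x \<le> b" "X \<le> b" by (auto simp: b_def)
  have mS: "((\<lambda>t. - S t) has_real_derivative u t) (at t)" for t
    using DERIV_minus[OF dS[of t]] by simp
  have "- S x \<le> 0" "- S b > 0" using \<open>\<not> S x < 0\<close> late[of b] b by simp_all
  then obtain c where c': "x \<le> c" "c < b" "- S c = 0" "u c \<ge> 0"
      "\<And>t. c < t \<Longrightarrow> t \<le> b \<Longrightarrow> - S t > 0"
    using last_zero_deriv[OF mS b(1)] by blast
  then have c: "c < b" "S c = 0" "u c \<ge> 0" by simp_all
  have Sneg: "S t < 0" if "c < t" for t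
    using c'(5)[OF that] late[of t] b by (cases "t \<le> b") simp_all
  \<comment> \<open>If \<open>u\<close> vanished at \<open>c\<close> with negative slope,
    \<open>S\<close> would rise above 0 right after \<open>c\<close>; slope 0 is excluded by
    \<open>du_nonzero\<close>.\<close>
  have "\<exists>d>0. \<forall>h>0. h < d \<longrightarrow> u (c + h) > 0"
  proof -
    consider "u c > 0" | "u c = 0" "u' c > 0" | "u c = 0" "u' c < 0"
      using c(3) du_nonzero[of c] by linarith
    then show ?thesis
    proof cases
      case 1
      have "isCont u c" using du by (rule DERIV_isCont)
      then obtain d where d: "d > 0" "\<forall>t. dist t c < d \<longrightarrow> dist (u t) (u c) < u c"
        using 1 unfolding continuous_at_eps_delta by blast
      have "u (c + h) > 0" if "0 < h" "h < d" for h
        using d(2)[rule_format, of "c + h"] that by (simp add: dist_real_def)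
      then show ?thesis using d(1) by blast
    next
      case 2
      then show ?thesis using DERIV_pos_inc_right[OF du, of c] by auto
    next
      case 3
      then obtain d where d: "d > 0" "\<And>h. 0 < h \<Longrightarrow> h < d \<Longrightarrow> u (c + h) < 0"
        using DERIV_neg_dec_right[OF du, of c] by auto
      have "S c < S (c + d / 2)"
      proof (rule DERIV_pos_imp_increasing_open[where f = S])
        show "continuous_on {c..c + d / 2} S"
          by (rule DERIV_continuous_on) (rule has_field_derivative_at_within[OF dS])
        fix t assume "c < t" "t < c + d / 2"
        then have "- u t > 0" using d(2)[of "t - c"] \<open>d > 0\<close> by simp
        then show "\<exists>l. DERIV S t :> l \<and> l > 0" using dS by blast
      qed (use \<open>d > 0\<close> in simp)
      then show ?thesis using Sneg[of "c + d / 2"] c(2) \<open>d > 0\<close> by simp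
    qed
  qed
  then obtain d where d: "d > 0" "\<And>h. 0 < h \<Longrightarrow> h < d \<Longrightarrow> u (c + h) > 0" by blast
  define p where "p = c + d / 2"
  have p: "u t > 0" if "c < t" "t \<le> p" for t
    using d(2)[of "t - c"] that d(1) by (simp add: p_def)
  have ub: "u b < 0" by (rule neg) (simp add: b_def)
  have "p < b" using p[of b] ub c(1) by (cases "p < b") auto
  have cp: "c < p" using d by (simp add: p_def)
  have "p \<le> b" "u p > 0" "u b \<le> 0" using \<open>p < b\<close> ub p[of p] cp by simp_all
  then obtain a where a: "p < a" "a \<le> b" "u a = 0" "u' a \<le> 0"
      "\<And>t. p \<le> t \<Longrightarrow> t < a \<Longrightarrow> u t > 0"
    using first_zero_deriv[OF du, of p b] by blast
  have pos: "u (a - t) > 0" if "0 < t" "t < a - c" for t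
    using p[of "a - t"] a(5)[of "a - t"] that by (cases "a - t \<le> p") auto
  have a': "u' a < 0" using a(3,4) du_nonzero[of a] by linarith
  \<comment> \<open>\<Phi> compares the tails at points symmetric about \<open>a\<close>; its
    derivative is nonpositive by the lobe comparison.\<close>
  define \<Phi> where "\<Phi> t = S (a - t) - S (a + t)" for t
  have d\<Phi>: "(\<Phi> has_real_derivative u (a - t) + u (a + t)) (at t)" for t
    unfolding \<Phi>_def using DERIV_diff[OF DERIV_reflect[OF dS] DERIV_translate[OF dS]] by simp
  obtain t where t: "0 < t" "t < a - c" "\<Phi> (a - c) - \<Phi> 0 = (a - c - 0) * (u (a - t) + u (a + t))"
    using MVT2[of 0 "a - c" \<Phi> "\<lambda>t. u (a - t) + u (a + t)"] d\<Phi> a(1) cp by auto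
  have "(a - c - 0) * (u (a - t) + u (a + t)) \<le> 0"
    using lobe_comparison[OF a(3) a' pos t(1,2)] a(1) cp by (intro mult_nonneg_nonpos) auto
  then have "S c \<le> S (a + (a - c))" using t(3) by (simp add: \<Phi>_def)
  then show False using Sneg[of "a + (a - c)"] c(2) a(1) cp by simp
qed

section \<open>The region where \<open>y\<close> is positive\<close>

lemma dy: "(y has_real_derivative 1 + 2 * u x * y x) (at x)"
  unfolding y_def
  by (rule derivative_eq_intros du du' refl | simp add: algebra_simps power3_eq_cube power2_eq_square)+

text \<open>At a zero of \<open>y\<close> the derivative equals 1, so \<open>y\<close> can only
  cross upwards.\<close>

lemma y_pos_mono:
  assumes "y a > 0" "a \<le> b"
  shows "y b > 0"
proof (rule ccontr)
  assume "\<not> y b > 0"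
  then obtain c where "y c = 0" "1 + 2 * u c * y c \<le> 0"
    using first_zero_deriv[OF dy, of a b] assms by (auto simp: not_less)
  then show False by simp
qed

text \<open>Otherwise \<open>u\<close> has a last zero \<open>c\<close> with \<open>u' c\<close>
  nonpositive. Positivity of \<open>y c = c + 2 * u' c\<close> puts \<open>c\<close> on the
  nonnegative axis, where concavity keeps \<open>u'\<close> nonpositive ever after, so
  \<open>u\<close> cannot return to 0 at infinity.\<close>

lemma u_neg_if_y_pos:
  assumes "y a > 0"
  shows "u a < 0"
proof (rule ccontr)
  assume "\<not> u a < 0"
  define b where "b = max a X"
  have b: "a \<le> b" "X \<le> b" by (auto simp: b_def)
  have mu: "((\<lambda>t. - u t) has_real_derivative - u' t) (at t)" for t
    by (rule DERIV_minus[OF du])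
  have ub: "u b < 0" by (rule neg) (simp add: b_def)
  have "- u a \<le> 0" "- u b > 0" using \<open>\<not> u a < 0\<close> ub by simp_all
  then obtain c where c': "a \<le> c" "c < b" "- u c = 0" "- u' c \<ge> 0"
      "\<And>t. c < t \<Longrightarrow> t \<le> b \<Longrightarrow> - u t > 0"
    using last_zero_deriv[OF mu b(1)] by blast
  then have c: "a \<le> c" "c < b" "u c = 0" "u' c \<le> 0" by simp_all
  have "u t \<le> 0" if "c \<le> t" for t
    using c'(5)[of t] neg[of t] c(3) that b by (cases "t = c"; cases "t \<le> b") simp_all
  moreover have "c \<ge> 0" using y_pos_mono[OF assms c(1)] c(3,4) by (simp add: y_def)
  ultimately have "u' t \<le> 0" if "b \<le> t" for t
    using concave[of c t] c that by auto
  with ub show False by (rule not_nonincreasing)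
qed

text \<open>At a zero of \<open>u'\<close> one has \<open>y = x + 2 * u^2\<close>, so
  \<open>u'' = u * y < 0\<close> and \<open>u'\<close> cannot become positive again. Staying
  nonpositive contradicts the decay of \<open>u\<close>.\<close>

lemma du_pos_if_y_pos:
  assumes "y a > 0"
  shows "u' a > 0"
proof (rule ccontr)
  assume a: "\<not> u' a > 0"
  have "u' b \<le> 0" if b: "a \<le> b" for b
  proof (rule ccontr)
    assume "\<not> u' b \<le> 0"
    then have "u' a \<le> 0" "u' b > 0" using a by simp_all
    then obtain c where c: "a \<le> c" "c < b" "u' c = 0" "2 * u c ^ 3 + c * u c \<ge> 0"
        "\<And>t. c < t \<Longrightarrow> t \<le> b \<Longrightarrow> u' t > 0"
      using last_zero_deriv[OF du' b] by blast
    have yc: "y c > 0" using y_pos_mono[OF assms c(1)] .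
    then have "u c * (c + 2 * (u c)\<^sup>2) < 0"
      using u_neg_if_y_pos[OF yc] yc c(3) by (intro mult_neg_pos) (auto simp: y_def)
    then show False using c(4) by (simp add: algebra_simps power3_eq_cube power2_eq_square)
  qed
  then show False using not_nonincreasing[OF u_neg_if_y_pos[OF assms]] by blast
qed

lemma ddy:
  "((\<lambda>x. 1 + 2 * u x * y x) has_real_derivative 2 * u' x * y x + 2 * u x * (1 + 2 * u x * y x)) (at x)"
  by (rule derivative_eq_intros du dy refl | simp add: algebra_simps)+

text \<open>Otherwise \<open>y\<close> would be convex and decreasing on a left half-line, where
  \<open>y'' = y\<^sup>2 - x y + 2 u\<^sup>2 y + 2 u \<ge> y\<^sup>2\<close> forces a blow-up at a finite point: this is where the
  existence of \<open>u\<close> on the whole line enters.\<close>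

lemma dy_pos_if_y_pos:
  assumes "y a > 0"
  shows "1 + 2 * u a * y a > 0"
proof (rule ccontr)
  define m where "m x = 1 + 2 * u x * y x" for x
  assume "\<not> 1 + 2 * u a * y a > 0"
  then have ma: "m a \<le> 0" by (simp add: m_def)
  have dy: "(y has_real_derivative m x) (at x)" for x unfolding m_def by (rule dy)
  have dm: "(m has_real_derivative 2 * u' x * y x + 2 * u x * m x) (at x)" for x
    unfolding m_def by (rule ddy)
  \<comment> \<open>At a zero of \<open>m\<close> its derivative is \<open>2 * u' * y > 0\<close>,
    so \<open>m\<close> cannot come down to 0 from positive values.\<close>
  have m_nonpos: "m x \<le> 0" if x: "x \<le> a" "y x > 0" for x
  proof (rule ccontr)
    assume "\<not> m x \<le> 0"
    then have "m x > 0" by simp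
    then obtain c where c: "x < c" "c \<le> a" "m c = 0" "2 * u' c * y c + 2 * u c * m c \<le> 0"
        "\<And>t. x \<le> t \<Longrightarrow> t < c \<Longrightarrow> m t > 0"
      using ma first_zero_deriv[OF dm x(1)] by blast
    have yc: "y c > 0" using y_pos_mono[OF x(2)] c(1) by simp
    then have "u' c * y c > 0" using du_pos_if_y_pos by simp
    then show False using c(3,4) by simp
  qed
  \<comment> \<open>To the left of \<open>a\<close>, \<open>y\<close> only grows as long as it is
    positive, so it never reaches 0.\<close>
  have y_pos: "y x > 0" if x: "x \<le> a" for x
  proof (rule ccontr)
    assume "\<not> y x > 0"
    then have "y x \<le> 0" by simp
    then obtain c where c: "x \<le> c" "c < a" "y c = 0" "m c \<ge> 0"
        "\<And>t. c < t \<Longrightarrow> t \<le> a \<Longrightarrow> y t > 0"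
      using assms last_zero_deriv[OF dy x] by blast
    obtain t where t: "c < t" "t < a" "y a - y c = (a - c) * m t"
      using MVT2[of c a y m] dy c(2) by auto
    have "(a - c) * m t \<le> 0" using m_nonpos[of t] c(2) c(5)[of t] t by (intro mult_nonneg_nonpos) simp_all
    then show False using t(3) c(3) assms by simp
  qed
  have dm_pos: "2 * u' x * y x + 2 * u x * m x > 0" if "x \<le> a" for x
  proof -
    have yx: "y x > 0" using y_pos[OF that] .
    have "u' x * y x > 0" using du_pos_if_y_pos[OF yx] yx by simp
    moreover have "u x * m x \<ge> 0"
      using u_neg_if_y_pos[OF yx] m_nonpos[OF that yx] by (intro mult_nonpos_nonpos) auto
    ultimately show ?thesis by simp
  qed
  \<comment> \<open>At \<open>a\<close> the slope \<open>m\<close> might be 0; one unit to the left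
    it is strictly negative, because \<open>m\<close> is strictly increasing.\<close>
  define a1 where "a1 = a - 1"
  have "m a1 < m a"
  proof (rule DERIV_pos_imp_increasing[where f = m])
    fix t assume "t \<le> a"
    then show "\<exists>l. DERIV m t :> l \<and> l > 0" using dm dm_pos by blast
  qed (simp add: a1_def)
  define \<mu> where "\<mu> = - m a1"
  have \<mu>: "\<mu> > 0" using \<open>m a1 < m a\<close> ma by (simp add: \<mu>_def)
  have m_le: "m x \<le> - \<mu>" if "x \<le> a1" for x
  proof -
    have "m x \<le> m a1"
    proof (rule DERIV_nonneg_imp_nondecreasing[OF that])
      fix t assume "t \<le> a1"
      then show "\<exists>l. DERIV m t :> l \<and> l \<ge> 0"
        using dm dm_pos[of t] by (intro exI conjI) (auto simp: a1_def)
    qed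
    then show ?thesis by (simp add: \<mu>_def)
  qed
  have y_lin: "y x \<ge> \<mu> * (a1 - x)" if x: "x \<le> a1" for x
  proof -
    have "y a1 + \<mu> * a1 \<le> y x + \<mu> * x"
    proof (rule DERIV_nonpos_imp_nonincreasing[OF x])
      fix t assume "t \<le> a1"
      moreover have "((\<lambda>x. y x + \<mu> * x) has_real_derivative m t + \<mu>) (at t)"
        by (rule derivative_eq_intros dy refl | simp)+
      ultimately show "\<exists>l. DERIV (\<lambda>x. y x + \<mu> * x) t :> l \<and> l \<le> 0" using m_le by fastforce
    qed
    then show ?thesis using y_pos[of a1] by (simp add: a1_def algebra_simps)
  qed
  define s0 where "s0 = max 1 (max (- a1) (1 / \<mu> - a1))"
  have s0: "1 \<le> s" "- s \<le> a1" "1 \<le> y (- s)" if "s \<ge> s0" for s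
  proof -
    show s: "1 \<le> s" "- s \<le> a1" using that by (auto simp: s0_def)
    have "1 / \<mu> \<le> a1 + s" using that by (auto simp: s0_def)
    then have "1 \<le> \<mu> * (a1 - (- s))" using \<mu> by (simp add: field_simps)
    then show "1 \<le> y (- s)" using y_lin[OF s(2)] by simp
  qed
  define z z' z'' where "z s = y (- s)" and "z' s = - m (- s)"
    and "z'' s = 2 * u' (- s) * y (- s) + 2 * u (- s) * m (- s)" for s
  have "(z has_real_derivative z' s) (at s)" for s
    unfolding z_def z'_def using DERIV_reflect[OF dy, of 0] by simp
  moreover have "(z' has_real_derivative z'' s) (at s)" for s
    unfolding z'_def z''_def using DERIV_minus[OF DERIV_reflect[OF dm, of 0]] by (simp add: add.commute)
  moreover have "(z s)\<^sup>2 \<le> z'' s" if "s \<ge> s0" for s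
  proof -
    define x where "x = - s"
    have "2 * u' x = y x - x - 2 * (u x)\<^sup>2" by (simp add: y_def)
    then have eq: "z'' s = (y x)\<^sup>2 + (- x) * y x + 2 * (u x)\<^sup>2 * y x + 2 * u x"
      unfolding z''_def m_def x_def[symmetric] by (simp only:) (simp add: algebra_simps power2_eq_square)
    \<comment> \<open>What is added to \<open>y^2\<close> is at least
      \<open>1 + 2 * u^2 + 2 * u\<close>, a sum of two squares.\<close>
    have "1 * 1 \<le> (- x) * y x" using s0[OF that] by (intro mult_mono) (auto simp: x_def)
    moreover have "2 * (u x)\<^sup>2 * 1 \<le> 2 * (u x)\<^sup>2 * y x"
      using s0[OF that] by (intro mult_left_mono) (auto simp: x_def)
    moreover have "2 * (u x)\<^sup>2 + 2 * u x + 1 \<ge> 0"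
    proof -
      have "0 \<le> (u x)\<^sup>2 + (u x + 1)\<^sup>2" by simp
      also have "\<dots> = 2 * (u x)\<^sup>2 + 2 * u x + 1" by (simp add: power2_eq_square algebra_simps)
      finally show ?thesis .
    qed
    ultimately show ?thesis unfolding eq by (simp add: z_def x_def)
  qed
  moreover have "1 \<le> z s" if "s \<ge> s0" for s using s0[OF that] by (simp add: z_def)
  moreover have "\<mu> \<le> z' s" if "s \<ge> s0" for s using m_le s0(2)[OF that] by (fastforce simp: z'_def)
  ultimately show False using \<mu> by (rule superquadratic_blow_up)
qed

section \<open>The ratio of the two distributions\<close>

definition "G x = (1 - y x * v x) * exp (3 / 2 * S x + 1 / 2 * V x)"

lemma dG: "(G has_real_derivative
    1 / 2 * exp (3 / 2 * S x + 1 / 2 * V x) * ((u x + v x) * (y x * (v x - 2 * u x) - 3))) (at x)"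
proof -
  have "((\<lambda>x. 1 - y x * v x) has_real_derivative
      - ((1 + 2 * u x * y x) * v x + y x * (u x)\<^sup>2)) (at x)"
    by (rule derivative_eq_intros dy dv refl | simp)+
  moreover have "((\<lambda>x. exp (3 / 2 * S x + 1 / 2 * V x)) has_real_derivative
      exp (3 / 2 * S x + 1 / 2 * V x) * (3 / 2 * - u x + 1 / 2 * - v x)) (at x)"
    by (intro DERIV_fun_exp DERIV_add DERIV_cmult dS dV)
  ultimately show ?thesis
    unfolding G_def by (rule DERIV_cong[OF DERIV_mult]) (simp add: field_simps power2_eq_square)
qed

text \<open>Since \<open>y\<close> grows linearly, the term that matters is \<open>x * v x\<close>,
  which the exponential decay of \<open>v\<close> sends to 0.\<close>

lemma G_tendsto: "(G \<longlongrightarrow> 1) at_top"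
proof -
  note v0 = exp_bound_tendsto_0[of X v, OF v_decay]
  have "((\<lambda>x. (1 - (x * v x + 2 * u' x * v x + 2 * (u x)\<^sup>2 * v x)) * exp (3 / 2 * S x + 1 / 2 * V x))
      \<longlongrightarrow> (1 - (0 + 2 * 0 * 0 + 2 * 0\<^sup>2 * 0)) * exp (3 / 2 * 0 + 1 / 2 * 0)) at_top"
    by (intro tendsto_intros v0 u_tendsto du_tendsto S_tendsto V_tendsto)
  then show ?thesis by (simp add: G_def[abs_def] y_def algebra_simps)
qed

lemma G_less_1_if_y_pos:
  assumes "y a > 0"
  shows "G a < 1"
proof -
  have incr: "G s < G t" if "a \<le> s" "s < t" for s t
  proof (rule DERIV_pos_imp_increasing[OF that(2)])
    fix x assume "s \<le> x"
    then have yx: "y x > 0" using y_pos_mono[OF assms] that by simp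
    have "y x * v x < 0" using yx v_neg by (simp add: mult_pos_neg)
    then have "y x * (v x - 2 * u x) - 3 < 0"
      using dy_pos_if_y_pos[OF yx] by (simp add: algebra_simps)
    moreover have "u x + v x < 0" using u_neg_if_y_pos[OF yx] v_neg[of x] by simp
    ultimately have "(u x + v x) * (y x * (v x - 2 * u x) - 3) > 0" by (intro mult_neg_neg)
    then have "1 / 2 * exp (3 / 2 * S x + 1 / 2 * V x) * ((u x + v x) * (y x * (v x - 2 * u x) - 3)) > 0"
      by simp
    then show "\<exists>l. DERIV G x :> l \<and> l > 0" using dG by blast
  qed
  \<comment> \<open>The intermediate point \<open>a + 1\<close> keeps the inequality strict, since
    comparison with the limit gives only a weak one.\<close>
  have "G a < G (a + 1)" by (rule incr) auto
  also have "G (a + 1) \<le> 1"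
    by (rule tendsto_lowerbound[OF G_tendsto])
       (auto simp: eventually_at_top_linorder intro!: exI[of _ "a + 2"] less_imp_le incr)
  finally show ?thesis .
qed

lemma G_less_1: "G x < 1"
proof (cases "y x > 0")
  case False
  let ?e = "exp (3 / 2 * S x + 1 / 2 * V x)"
  have e: "?e < 1" using S_neg[of x] V_neg[of x] by simp
  have "1 - y x * v x \<le> 1" using False v_neg[of x] by (simp add: mult_nonpos_nonpos)
  then have "(1 - y x * v x) * ?e \<le> 1 * ?e" by (rule mult_right_mono) simp
  then show ?thesis unfolding G_def using e by linarith
qed (rule G_less_1_if_y_pos)

end

theorem theoremA1:
  fixes u :: "real \<Rightarrow> real"
  assumes "hastings_mcleod u"
  shows "\<forall>r::real. F_stat0 u r < F_GOE u r"
proof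
  fix r :: real
  have PII: "\<And>x. (u has_real_derivative deriv u x) (at x)"
      "\<And>x. (deriv u has_real_derivative (2 * u x ^ 3 + x * u x)) (at x)"
    and equiv: "u \<sim>[at_top] (\<lambda>x. - airy_Ai x)"
    using assms unfolding hastings_mcleod_def painleve_II_def
    by (auto simp: DERIV_deriv_iff_real_differentiable)
  have "\<forall>\<^sub>F x in at_top. - airy_Ai x \<noteq> 0"
    using eventually_ge_at_top[of 9] by eventually_elim (use airy_Ai_bounds(1) in force)
  \<comment> \<open>Asymptotic equivalence reads 0/0 as 1; since the Airy function is eventually
    nonzero, it becomes a plain limit of quotients.\<close>
  then have "((\<lambda>x. u x / - airy_Ai x) \<longlongrightarrow> 1) at_top"
    using asymp_equivD_strong[OF equiv] by (simp add: eventually_mono)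
  \<comment> \<open>Distance below 1 puts the quotient strictly between 0 and 2, which yields both
    the sign of \<open>u\<close> and the constant 2 in its decay.\<close>
  then have "\<forall>\<^sub>F x in at_top. dist (u x / - airy_Ai x) 1 < 1"
    by (rule tendstoD) simp
  then obtain N where N: "\<And>x. N \<le> x \<Longrightarrow> dist (u x / - airy_Ai x) 1 < 1"
    unfolding eventually_at_top_linorder by blast
  define X where "X = max N 9"
  have *: "u x < 0 \<and> \<bar>u x\<bar> \<le> 2 * exp (- x)" if "X \<le> x" for x
  proof -
    have A: "0 < airy_Ai x" "airy_Ai x \<le> exp (- x)" using airy_Ai_bounds[of x] that by (auto simp: X_def)
    have "0 < u x / - airy_Ai x" "u x / - airy_Ai x < 2"
      using N[of x] that by (auto simp: X_def dist_real_def)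
    then have "u x < 0" "- u x < 2 * airy_Ai x" using A(1) by (auto simp: field_simps zero_less_divide_iff)
    then show ?thesis using A by simp
  qed
  interpret decaying_painleve_II u "deriv u" 2 X
    by unfold_locales (use PII * in \<open>auto simp: X_def\<close>)
  have v: "hm_v u = v" by (simp add: fun_eq_iff hm_v_def v_def)
  have F: "hm_F u r = exp (1 / 2 * V r)" by (simp add: hm_F_def V_def v)
  have E: "hm_E u r = exp (1 / 2 * S r)" by (simp add: hm_E_def S_def)
  have "hm_E u r ^ 3 * hm_F u r = exp (3 / 2 * S r + 1 / 2 * V r)"
    unfolding E F by (simp add: exp_add flip: exp_of_nat_mult)
  then have "F_stat0 u r = G r * F_GOE u r"
    unfolding F_stat0_def F_GUE_def F_GOE_def G_def v
    by (simp add: hm_y_def y_def power2_eq_square power3_eq_cube power4_eq_xxxx mult_ac)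
  moreover have "F_GOE u r > 0" by (simp add: F_GOE_def F E)
  ultimately show "F_stat0 u r < F_GOE u r" using G_less_1[of r] by simp
qed

end
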